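(* Let $\mathcal{H}$ be a separable Hilbert space, let $g,h\in\mathcal{H}$, and let $A$ be a bounded linear operator on $\mathcal{H}$. Suppose that: (i) any $f\in\mathcal{H}$ is recovered from the samples $\{\langle A^n f,g\rangle\}_{n\ge 0}$ in a stable way, and there exist real numbers $\lambda,\mu,\nu\ge 0$ such that for all $l\in\mathbb{Z}^+$ and all scalars $a_0,\dots,a_l$, $$\Big\|\sum_{n=0}^{l}a_n(A^* )^n(g-h)\Big\|^2\le \lambda\Big\|\sum_{n=0}^{l}a_n(A^* )^n g\Big\|^2+\mu\Big\|\sum_{n=0}^{l}a_n(A^* )^n g\Big\|\,\Big\|\sum_{n=0}^{l}a_n(A^* )^n h\Big\|+\nu\Big\|\sum_{n=0}^{l}a_n(A^* )^n h\Big\|^2;$$ (ii) for some real $\epsilon>0$, these same $\lambda,\mu,\nu$ satisfy both $$2(1-\nu)\epsilon^2-(\mu+2\nu)\epsilon-\mu>0\quad\text{and}\quad \max\Big\{\lambda+\frac{\mu\epsilon}{2},\ \frac{\mu}{2\epsilon}+\nu\Big\}<1.$$ Then any $f\in\mathcal{H}$ can also be recovered from the samples $\{\langle A^n f,h\rangle\}_{n\ge 0}$ in a stable way.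
   Context: $\mathbb{Z}^+=\{0,1,2,\dots\}$, and $A^*$ denotes the Hilbert-space adjoint of $A$. For a bounded linear operator $C$ on $\mathcal{H}$ and a vector $u\in\mathcal{H}$, "any $f\in\mathcal{H}$ is (can be) recovered from the samples $\{\langle C^n f,u\rangle\}_{n\ge 0}$ in a stable way" means: for every $f\in\mathcal{H}$ the sequence $\{\langle C^n f,u\rangle\}_{n\ge0}$ belongs to $\ell^2(\mathbb{Z}^+)$, and there exists a bounded linear operator $\mathscr{R}:\ell^2(\mathbb{Z}^+)\to\mathcal{H}$ such that $\mathscr{R}(\{\langle C^n f,u\rangle\}_{n\ge0})=f$ for all $f\in\mathcal{H}$. *)

theory Defs
  imports
    "HOL-Analysis.Analysis"
    "Jordan_Normal_Form.Conjugate"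
begin

text \<open>
  The axiom below leaves, up to isomorphism, only the two scalar fields of Hilbert spaces:
  \<open>conjugate x = x\<close> forces \<open>x = \<plusminus>norm x\<close>, so the fixed field of the conjugation is the real line,
  over which the field has degree 1 or 2.
\<close>

class real_or_complex = real_normed_field + conjugatable_field +
  assumes mult_conjugate: "x * conjugate x = (norm x)\<^sup>2 *\<^sub>R 1"

instance real :: real_or_complex
  by standard (simp add: power2_eq_square)

instance complex :: real_or_complex
proof
  show "x * conjugate x = (norm x)\<^sup>2 *\<^sub>R 1" for x :: complex
    using complex_norm_square[of x] by (simp add: of_real_def)
qed

text \<open>
  Completeness is the sort \<open>banach\<close> of the vectors. The inner product is linear in the first
  argument.
\<close>

locale hilbert_space = vector_space scaleK
  for scaleK :: "'k::real_or_complex \<Rightarrow> 'h::banach \<Rightarrow> 'h" +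
  fixes ip :: "'h \<Rightarrow> 'h \<Rightarrow> 'k"
  assumes scale_of_real: "scaleK (of_real r) x = r *\<^sub>R x"
    and ip_add_left: "ip (x + y) z = ip x z + ip y z"
    and ip_scale_left: "ip (scaleK c x) y = c * ip x y"
    and ip_commute: "ip y x = conjugate (ip x y)"
    and ip_self: "ip x x = of_real ((norm x)\<^sup>2)"

lemma hilbert_space_real_inner:
  "hilbert_space (scaleR :: real \<Rightarrow> 'a::{real_inner,banach} \<Rightarrow> 'a) inner"
proof unfold_locales
  show "inner y x = conjugate (inner x y)" for x y :: 'a
    by (simp add: inner_commute)
qed (simp_all add: scaleR_add_right scaleR_add_left inner_add_left power2_norm_eq_inner)

lemma hilbert_space_complex:
  "hilbert_space ((*) :: complex \<Rightarrow> complex \<Rightarrow> complex) (\<lambda>x y. x * cnj y)"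
  by unfold_locales
    (simp_all add: ring_distribs mult.commute scaleR_conv_of_real flip: complex_norm_square)

definition bounded_operator :: "('k::field \<Rightarrow> 'h::real_normed_vector \<Rightarrow> 'h) \<Rightarrow> ('h \<Rightarrow> 'h) \<Rightarrow> bool" where
  "bounded_operator scaleK A \<longleftrightarrow>
     Vector_Spaces.linear scaleK scaleK A \<and> (\<exists>M. \<forall>x. norm (A x) \<le> M * norm x)"

text \<open>
  The library constant \<open>adjoint\<close> is restricted to real inner products. The description is proper
  for every bounded operator on a Hilbert space, by the Riesz representation theorem.
\<close>

definition hilbert_adjoint :: "('h \<Rightarrow> 'h \<Rightarrow> 'k) \<Rightarrow> ('h \<Rightarrow> 'h) \<Rightarrow> 'h \<Rightarrow> 'h" where
  "hilbert_adjoint ip A = (THE B. \<forall>x y. ip (A x) y = ip x (B y))"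

definition ell2 :: "(nat \<Rightarrow> 'k::real_normed_field) set" where
  "ell2 = {c. summable (\<lambda>n. (norm (c n))\<^sup>2)}"

definition ell2_norm :: "(nat \<Rightarrow> 'k::real_normed_field) \<Rightarrow> real" where
  "ell2_norm c = sqrt (\<Sum>n. (norm (c n))\<^sup>2)"

definition bounded_linear_on_ell2 ::
  "('k::real_normed_field \<Rightarrow> 'h::real_normed_vector \<Rightarrow> 'h) \<Rightarrow> ((nat \<Rightarrow> 'k) \<Rightarrow> 'h) \<Rightarrow> bool" where
  "bounded_linear_on_ell2 scaleK R \<longleftrightarrow>
     (\<forall>c\<in>ell2. \<forall>d\<in>ell2. R (\<lambda>n. c n + d n) = R c + R d) \<and>
     (\<forall>k. \<forall>c\<in>ell2. R (\<lambda>n. k * c n) = scaleK k (R c)) \<and>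
     (\<exists>M. \<forall>c\<in>ell2. norm (R c) \<le> M * ell2_norm c)"

definition samples :: "('h \<Rightarrow> 'h \<Rightarrow> 'k) \<Rightarrow> ('h \<Rightarrow> 'h) \<Rightarrow> 'h \<Rightarrow> 'h \<Rightarrow> nat \<Rightarrow> 'k" where
  "samples ip C u f = (\<lambda>n. ip ((C ^^ n) f) u)"

definition stably_recoverable ::
  "('k::real_normed_field \<Rightarrow> 'h::real_normed_vector \<Rightarrow> 'h) \<Rightarrow> ('h \<Rightarrow> 'h \<Rightarrow> 'k) \<Rightarrow> ('h \<Rightarrow> 'h) \<Rightarrow> 'h \<Rightarrow> bool"
  where
  "stably_recoverable scaleK ip C u \<longleftrightarrow>
     (\<forall>f. samples ip C u f \<in> ell2) \<and>
     (\<exists>R. bounded_linear_on_ell2 scaleK R \<and> (\<forall>f. R (samples ip C u f) = f))"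

end

theory Submission
  imports Defs
begin

text \<open>
  Since \<open>ip ((A ^^ n) f) u\<close> is the inner product of \<open>f\<close> with the \<open>n\<close>-th iterate of \<open>u\<close> under the
  adjoint, stable recovery means that these iterates form a frame: the upper frame bound is an
  instance of uniform boundedness, and conversely the inverse of the frame operator composed with
  synthesis is a recovery operator. For finite combinations \<open>X\<close> and \<open>Y\<close> of the two orbits with the
  same coefficients, AM-GM with weight \<open>\<epsilon>\<close> turns the hypothesis into
  \<open>\<parallel>X - Y\<parallel>\<^sup>2 \<le> p \<parallel>X\<parallel>\<^sup>2 + q \<parallel>Y\<parallel>\<^sup>2\<close> with \<open>p, q < 1\<close>. The triangle inequality then bounds \<open>\<parallel>Y\<parallel>\<close> by a
  multiple of \<open>\<parallel>X\<parallel>\<close>, which gives the upper frame bound of the orbit of \<open>h\<close>. For the lower one,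
  expand \<open>f\<close> in the frame of \<open>g\<close> and let \<open>v\<close> be the combination of the orbit of \<open>h\<close> with the same
  coefficients: \<open>\<parallel>f - v\<parallel>\<^sup>2 \<ge> \<parallel>f\<parallel>\<^sup>2 + \<parallel>v\<parallel>\<^sup>2 - 2 \<bar>ip v f\<bar>\<close> forces \<open>(1 - p) \<parallel>f\<parallel>\<^sup>2 \<le> 2 \<bar>ip v f\<bar>\<close>, and the
  right-hand side is controlled by the samples of \<open>f\<close>.
\<close>

section \<open>Conjugation on the scalar field and finite sections of the \<open>ell2\<close>
  norm\<close>

lemma mult_conjugate_of_real: "c * conjugate c = of_real ((norm c)\<^sup>2)"
  for c :: "'k::real_or_complex"
  by (simp add: mult_conjugate of_real_def)

text \<open>A nonnegative real has the form \<open>x * conjugate x\<close>, which conjugation fixes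
  because it only swaps the factors. Negative reals follow by changing sign.\<close>

lemma conjugate_of_real [simp]: "conjugate (of_real r :: 'k::real_or_complex) = of_real r"
proof -
  have nonneg: "conjugate (of_real s :: 'k) = of_real s" if "s \<ge> 0" for s
  proof -
    define x :: 'k where "x = of_real (sqrt s)"
    have x: "x * conjugate x = of_real s"
      using that by (simp add: mult_conjugate_of_real x_def)
    have "conjugate (x * conjugate x) = x * conjugate x"
      by (simp add: conjugate_dist_mul mult.commute)
    then show ?thesis by (simp add: x)
  qed
  show ?thesis
  proof (cases "r \<ge> 0")
    case False
    then have "conjugate (of_real (- r) :: 'k) = of_real (- r)"
      by (intro nonneg) simp
    then show ?thesis by (simp add: conjugate_neg)
  qed (rule nonneg)
qed

lemma norm_conjugate [simp]: "norm (conjugate c) = norm c"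
  for c :: "'k::real_or_complex"
proof (cases "c = 0")
  case False
  have "norm c * norm (conjugate c) = (norm c)\<^sup>2"
    using arg_cong[OF mult_conjugate_of_real[of c], of norm] by (simp add: norm_mult norm_power)
  with False show ?thesis by (simp add: power2_eq_square)
qed simp

lemma power2_ell2_norm: "c \<in> ell2 \<Longrightarrow> (ell2_norm c)\<^sup>2 = (\<Sum>n. (norm (c n))\<^sup>2)"
  by (simp add: ell2_def ell2_norm_def suminf_nonneg)

lemma sum_le_ell2_norm: "c \<in> ell2 \<Longrightarrow> (\<Sum>n<N. (norm (c n))\<^sup>2) \<le> (ell2_norm c)\<^sup>2"
  by (simp add: power2_ell2_norm) (simp add: ell2_def sum_le_suminf)

context hilbert_space
begin

section \<open>Inner product algebra and the Cauchy-Schwarz inequality\<close>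

lemma ip_zero_left [simp]: "ip 0 x = 0"
  using ip_scale_left[of 0 0 x] by simp

lemma ip_zero_right [simp]: "ip x 0 = 0"
  using ip_commute[of x 0] by simp

lemma ip_add_right: "ip x (y + z) = ip x y + ip x z"
  unfolding ip_commute[of x] by (simp add: ip_add_left conjugate_dist_add)

lemma ip_scale_right: "ip x (scaleK c y) = conjugate c * ip x y"
  unfolding ip_commute[of x] by (simp add: ip_scale_left conjugate_dist_mul)

lemma ip_minus_left: "ip (- x) y = - ip x y"
  using ip_scale_left[of "- 1" x y] by simp

lemma ip_minus_right: "ip x (- y) = - ip x y"
  unfolding ip_commute[of x] by (simp add: ip_minus_left conjugate_neg)

lemma ip_diff_left: "ip (x - y) z = ip x z - ip y z"
  using ip_add_left[of x "- y" z] by (simp add: ip_minus_left)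

lemma ip_diff_right: "ip x (y - z) = ip x y - ip x z"
  using ip_add_right[of x y "- z"] by (simp add: ip_minus_right)

lemma ip_sum_left: "ip (\<Sum>i\<in>I. f i) y = (\<Sum>i\<in>I. ip (f i) y)"
  by (induction I rule: infinite_finite_induct) (simp_all add: ip_add_left)

lemma norm_ip_commute: "norm (ip x y) = norm (ip y x)"
  unfolding ip_commute[of x y] by simp

lemma ip_self_zero_iff: "ip x x = 0 \<longleftrightarrow> x = 0"
  by (simp add: ip_self)

lemma ip_right_eqI: "(\<And>x. ip x y = ip x z) \<Longrightarrow> y = z"
  using ip_self_zero_iff[of "y - z"] by (simp add: ip_diff_right)

text \<open>The type class of the vectors gives homogeneity for real scalars only. For scalars in
  \<open>'k\<close> it comes from \<open>ip_self\<close>, read back through the injective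
  \<open>of_real\<close>.\<close>

lemma norm_scaleK: "norm (scaleK c x) = norm c * norm x"
proof -
  have "of_real ((norm (scaleK c x))\<^sup>2) = (of_real ((norm c * norm x)\<^sup>2) :: 'k)"
  proof -
    have "ip (scaleK c x) (scaleK c x) = (c * conjugate c) * ip x x"
      by (simp add: ip_scale_left ip_scale_right)
    then show ?thesis
      by (simp add: mult_conjugate_of_real ip_self power_mult_distrib)
  qed
  then have "(norm (scaleK c x))\<^sup>2 = (norm c * norm x)\<^sup>2"
    by (simp only: of_real_eq_iff)
  then show ?thesis by simp
qed

text \<open>A scalar plus its conjugate stands for twice its real part, so the expansion of the
  square stays inside \<open>'k\<close>.\<close>

lemma of_real_norm_add_power2:
  "of_real ((norm (x + y))\<^sup>2) = of_real ((norm x)\<^sup>2 + (norm y)\<^sup>2) + (ip x y + conjugate (ip x y))"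
  by (simp add: ip_self[symmetric] ip_add_left ip_add_right ip_commute[of y x] del: of_real_power)

lemma norm_add_power2:
  assumes "ip x y = of_real r"
  shows "(norm (x + y))\<^sup>2 = (norm x)\<^sup>2 + (norm y)\<^sup>2 + 2 * r"
proof -
  have "of_real ((norm (x + y))\<^sup>2) = (of_real ((norm x)\<^sup>2 + (norm y)\<^sup>2 + 2 * r) :: 'k)"
    unfolding of_real_norm_add_power2 assms by simp
  then show ?thesis by (simp only: of_real_eq_iff)
qed

lemma norm_diff_power2_ge:
  "(norm x)\<^sup>2 + (norm y)\<^sup>2 - 2 * norm (ip x y) \<le> (norm (x - y))\<^sup>2"
proof -
  \<comment> \<open>\<open>r\<close> is the real cross term of \<open>x - y\<close>. Its image in
    \<open>'k\<close> is minus the sum of \<open>ip x y\<close> and its conjugate, so its modulus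
    can be estimated there.\<close>
  define r where "r = (norm (x - y))\<^sup>2 - (norm x)\<^sup>2 - (norm y)\<^sup>2"
  have "of_real r = - (ip x y + conjugate (ip x y))"
    using of_real_norm_add_power2[of x "- y"]
    by (simp add: r_def ip_minus_right conjugate_neg algebra_simps)
  then have "\<bar>r\<bar> = norm (ip x y + conjugate (ip x y))"
    by (metis norm_minus_cancel norm_of_real)
  also have "\<dots> \<le> 2 * norm (ip x y)"
    using norm_triangle_ineq[of "ip x y" "conjugate (ip x y)"] by simp
  finally show ?thesis by (simp add: r_def abs_le_iff)
qed

text \<open>Pythagoras for the component of \<open>x\<close> orthogonal to \<open>y\<close>.
  Nonnegativity of the left side is Cauchy-Schwarz; the exact decrease is what the Riesz argument
  uses.\<close>

lemma norm_minus_projection_power2: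
  assumes "y \<noteq> 0"
  shows "(norm (x - scaleK (ip x y / of_real ((norm y)\<^sup>2)) y))\<^sup>2
    = (norm x)\<^sup>2 - (norm (ip x y))\<^sup>2 / (norm y)\<^sup>2"
proof -
  define c where "c = ip x y / of_real ((norm y)\<^sup>2)"
  have cy: "c * of_real ((norm y)\<^sup>2) = ip x y"
    using assms by (simp add: c_def)
  have nc: "norm c = norm (ip x y) / (norm y)\<^sup>2"
    by (simp add: c_def norm_divide norm_power)
  have "ip x (- scaleK c y) = - (c * conjugate c * of_real ((norm y)\<^sup>2))"
    by (simp add: ip_minus_right ip_scale_right cy[symmetric] del: of_real_power)
  also have "\<dots> = of_real (- ((norm c)\<^sup>2 * (norm y)\<^sup>2))"
    by (simp add: mult_conjugate_of_real)
  finally have "(norm (x + - scaleK c y))\<^sup>2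
      = (norm x)\<^sup>2 + (norm (- scaleK c y))\<^sup>2 + 2 * (- ((norm c)\<^sup>2 * (norm y)\<^sup>2))"
    by (rule norm_add_power2)
  also have "\<dots> = (norm x)\<^sup>2 - (norm c)\<^sup>2 * (norm y)\<^sup>2"
    by (simp add: norm_scaleK power_mult_distrib)
  also have "\<dots> = (norm x)\<^sup>2 - (norm (ip x y))\<^sup>2 / (norm y)\<^sup>2"
    using assms by (simp add: nc power_divide power2_eq_square)
  finally show ?thesis by (simp add: c_def)
qed

lemma norm_ip_le: "norm (ip x y) \<le> norm x * norm y"
proof (cases "y = 0")
  case False
  have "0 \<le> (norm x)\<^sup>2 - (norm (ip x y))\<^sup>2 / (norm y)\<^sup>2"
    unfolding norm_minus_projection_power2[OF False, symmetric] by simp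
  then have "(norm (ip x y))\<^sup>2 \<le> (norm x * norm y)\<^sup>2"
    using False by (simp add: field_simps)
  then show ?thesis by (rule power2_le_imp_le) simp
qed simp

lemma scaleK_scaleR: "scaleK c (r *\<^sub>R x) = r *\<^sub>R scaleK c x"
  by (metis scale_of_real scale_left_commute)

lemma bounded_linear_ip: "bounded_linear (\<lambda>x. ip x y)"
proof (rule bounded_linear_intro[where K = "norm y"])
  show "ip (r *\<^sub>R x) y = r *\<^sub>R ip x y" for r x
    by (simp add: scale_of_real[symmetric] ip_scale_left scaleR_conv_of_real)
qed (auto simp: ip_add_left norm_ip_le)

lemma bounded_linear_scaleK: "bounded_linear (scaleK c)"
  by (rule bounded_linear_intro[where K = "norm c"])
    (simp_all add: scale_right_distrib norm_scaleK scaleK_scaleR mult.commute)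

section \<open>The Riesz representation theorem and the adjoint\<close>

lemma parallelogram:
  fixes x y :: 'h
  shows "(norm (x + y))\<^sup>2 + (norm (x - y))\<^sup>2 = 2 * (norm x)\<^sup>2 + 2 * (norm y)\<^sup>2"
proof -
  have "of_real ((norm (x + y))\<^sup>2 + (norm (x - y))\<^sup>2)
      = (of_real (2 * (norm x)\<^sup>2 + 2 * (norm y)\<^sup>2) :: 'k)"
    using of_real_norm_add_power2[of x y] of_real_norm_add_power2[of x "- y"]
    by (simp add: ip_minus_right conjugate_neg)
  then show ?thesis by (simp only: of_real_eq_iff)
qed

text \<open>
  The representing vector is a multiple of the point of least norm on the affine hyperplane
  \<open>{x. \<phi> x = 1}\<close>.
\<close>

lemma riesz_representation:
  fixes \<phi> :: "'h \<Rightarrow> 'k"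
  assumes add: "\<And>x y. \<phi> (x + y) = \<phi> x + \<phi> y"
    and scale: "\<And>c x. \<phi> (scaleK c x) = c * \<phi> x"
    and bound: "\<And>x. norm (\<phi> x) \<le> M * norm x"
  shows "\<exists>y. \<forall>x. \<phi> x = ip x y"
proof (cases "\<forall>x. \<phi> x = 0")
  case True
  then show ?thesis by (intro exI[of _ 0]) simp
next
  case False
  then obtain x0 where x0: "\<phi> x0 \<noteq> 0" by blast
  have bl: "bounded_linear \<phi>"
  proof (rule bounded_linear_intro[where K = M])
    show "\<phi> (r *\<^sub>R x) = r *\<^sub>R \<phi> x" for r x
      by (simp add: scale_of_real[symmetric] scale scaleR_conv_of_real)
  qed (use add bound in \<open>auto simp: mult.commute\<close>)
  interpret \<phi>: bounded_linear \<phi> by (rule bl)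
  define S where "S = {x. \<phi> x = 1}"
  define d where "d = Inf ((\<lambda>x. (norm x)\<^sup>2) ` S)"
  have S_ne: "S \<noteq> {}"
    using x0 scale[of "1 / \<phi> x0" x0] by (auto simp: S_def)
  have bdd: "bdd_below ((\<lambda>x. (norm x)\<^sup>2) ` S)"
    by (rule bdd_belowI[of _ 0]) auto
  have d_le: "d \<le> (norm x)\<^sup>2" if "x \<in> S" for x
    unfolding d_def by (rule cInf_lower[OF _ bdd]) (use that in auto)
  have "\<exists>x\<in>S. (norm x)\<^sup>2 < d + 1 / real (Suc n)" for n
  proof -
    have "Inf ((\<lambda>x. (norm x)\<^sup>2) ` S) < d + 1 / real (Suc n)"
      by (simp add: d_def)
    with S_ne obtain v where "v \<in> (\<lambda>x. (norm x)\<^sup>2) ` S" "v < d + 1 / real (Suc n)"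
      using cInf_lessD by (metis image_is_empty)
    then show ?thesis by auto
  qed
  then obtain z where zS: "\<And>n. z n \<in> S" and z: "\<And>n. (norm (z n))\<^sup>2 < d + 1 / real (Suc n)"
    by metis
  have near: "(norm (z m - z n))\<^sup>2 \<le> 2 / real (Suc m) + 2 / real (Suc n)" for m n
  proof -
    \<comment> \<open>The midpoint stays on the hyperplane, so its squared norm is at least
      \<open>d\<close>. The parallelogram law then leaves little room for
      \<open>z m - z n\<close>.\<close>
    have "(1 / 2) *\<^sub>R (z m + z n) \<in> S"
      using zS[of m] zS[of n] by (simp add: S_def \<phi>.scaleR \<phi>.add scaleR_2[symmetric])
    from d_le[OF this] have "4 * d \<le> (norm (z m + z n))\<^sup>2"
      by (simp add: power_divide)
    then show ?thesis
      using parallelogram[of "z m" "z n"] z[of m] z[of n] by simp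
  qed
  have "Cauchy z"
  proof (rule metric_CauchyI)
    fix e :: real assume e: "0 < e"
    then obtain N where N: "inverse (real (Suc N)) < e\<^sup>2 / 4"
      using reals_Archimedean[of "e\<^sup>2 / 4"] by auto
    show "\<exists>M. \<forall>m\<ge>M. \<forall>n\<ge>M. dist (z m) (z n) < e"
    proof (intro exI allI impI)
      fix m n assume mn: "N \<le> m" "N \<le> n"
      have *: "1 / real (Suc k) < e\<^sup>2 / 4" if "N \<le> k" for k
      proof -
        have "1 / real (Suc k) \<le> inverse (real (Suc N))"
          using that by (simp add: inverse_eq_divide frac_le)
        with N show ?thesis by simp
      qed
      have "(norm (z m - z n))\<^sup>2 < e\<^sup>2"
        using near[of m n] *[OF mn(1)] *[OF mn(2)] by simp
      then show "dist (z m) (z n) < e"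
        using e by (simp add: dist_norm power2_less_imp_less)
    qed
  qed
  then obtain w where w: "z \<longlonglongrightarrow> w"
    using Cauchy_convergent_iff convergent_def by blast
  have "(\<lambda>n. \<phi> (z n)) \<longlonglongrightarrow> \<phi> w"
    by (rule \<phi>.tendsto[OF w])
  moreover have "\<phi> (z n) = 1" for n using zS by (simp add: S_def)
  ultimately have \<phi>w: "\<phi> w = 1"
    by (simp add: LIMSEQ_const_iff)
  then have w0: "w \<noteq> 0" using \<phi>.zero by auto
  have "(norm w)\<^sup>2 \<le> d"
  proof (rule LIMSEQ_le)
    show "(\<lambda>n. (norm (z n))\<^sup>2) \<longlonglongrightarrow> (norm w)\<^sup>2"
      by (intro tendsto_intros w)
    show "(\<lambda>n. d + 1 / real (Suc n)) \<longlonglongrightarrow> d"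
      using tendsto_add[OF tendsto_const[of d] LIMSEQ_inverse_real_of_nat]
      by (simp add: inverse_eq_divide)
    show "\<exists>N. \<forall>n\<ge>N. (norm (z n))\<^sup>2 \<le> d + 1 / real (Suc n)"
      using z less_imp_le by blast
  qed
  \<comment> \<open>Removing from \<open>w\<close> its projection onto a kernel vector stays in
    \<open>S\<close>, and would push the squared norm below \<open>d\<close> unless the two are
    orthogonal.\<close>
  have orth: "ip w k = 0" if k: "\<phi> k = 0" for k
  proof (cases "k = 0")
    case False
    have "w - scaleK (ip w k / of_real ((norm k)\<^sup>2)) k \<in> S"
      by (simp add: S_def \<phi>.diff scale k \<phi>w)
    from d_le[OF this] have "d \<le> (norm w)\<^sup>2 - (norm (ip w k))\<^sup>2 / (norm k)\<^sup>2"
      by (simp only: norm_minus_projection_power2[OF False])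
    with \<open>(norm w)\<^sup>2 \<le> d\<close> have "(norm (ip w k))\<^sup>2 / (norm k)\<^sup>2 \<le> 0" by simp
    with False show ?thesis by (simp add: divide_le_0_iff)
  qed simp
  show ?thesis
  proof (intro exI allI)
    fix x
    \<comment> \<open>Since \<open>\<phi> w = 1\<close>, the vector
      \<open>x - scaleK (\<phi> x) w\<close> lies in the kernel. The scalar in the witness is real,
      so conjugate linearity in the second argument does not change it.\<close>
    have "ip (x - scaleK (\<phi> x) w) w = 0"
      using orth[of "x - scaleK (\<phi> x) w"] ip_commute[of "x - scaleK (\<phi> x) w" w]
      by (simp add: \<phi>.diff scale \<phi>w)
    then have "ip x w = \<phi> x * of_real ((norm w)\<^sup>2)"
      by (simp add: ip_diff_left ip_scale_left ip_self)
    then show "\<phi> x = ip x (scaleK (of_real (1 / (norm w)\<^sup>2)) w)"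
      using w0 by (simp only: ip_scale_right conjugate_of_real) simp
  qed
qed

text \<open>The definite description is proper: Riesz represents
  \<open>\<lambda>x. ip (A x) y\<close> for each \<open>y\<close>, and \<open>ip_right_eqI\<close>
  makes the representing vector unique.\<close>

lemma ip_hilbert_adjoint:
  assumes "bounded_operator scaleK A"
  shows "ip (A x) y = ip x (hilbert_adjoint ip A y)"
proof -
  from assms obtain M where lin: "Vector_Spaces.linear scaleK scaleK A"
    and M: "\<And>x. norm (A x) \<le> M * norm x"
    unfolding bounded_operator_def by blast
  interpret A: Vector_Spaces.linear scaleK scaleK A by (rule lin)
  have "\<exists>z. \<forall>x. ip (A x) y = ip x z" for y
  proof (rule riesz_representation)
    show "norm (ip (A x) y) \<le> (M * norm y) * norm x" for x
    proof -
      have "norm (ip (A x) y) \<le> norm (A x) * norm y" by (rule norm_ip_le)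
      also have "\<dots> \<le> M * norm x * norm y" by (intro mult_right_mono M) simp
      finally show ?thesis by (simp add: mult_ac)
    qed
  qed (simp_all add: A.add A.scale ip_add_left ip_scale_left)
  then obtain B where B: "\<And>x y. ip (A x) y = ip x (B y)" by metis
  have "hilbert_adjoint ip A = B"
    unfolding hilbert_adjoint_def
  proof (rule the_equality)
    fix C assume C: "\<forall>x y. ip (A x) y = ip x (C y)"
    show "C = B"
      by (rule ext, rule ip_right_eqI) (metis B C)
  qed (use B in blast)
  with B show ?thesis by simp
qed

text \<open>This turns samples into coefficients against the adjoint orbit. \<open>y\<close> stays
  arbitrary because each induction step applies the adjoint to it once.\<close>

lemma ip_hilbert_adjoint_funpow:
  assumes "bounded_operator scaleK A"
  shows "ip ((A ^^ n) x) y = ip x ((hilbert_adjoint ip A ^^ n) y)"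
  by (induction n arbitrary: y)
    (simp_all add: ip_hilbert_adjoint[OF assms] funpow_swap1[where f = "hilbert_adjoint ip A"])

text \<open>Tested against any vector, the powers move back to the left argument, where the
  difference splits. This separates the orbit of \<open>g - h\<close> in the hypothesis of the
  theorem.\<close>

lemma hilbert_adjoint_funpow_diff:
  assumes "bounded_operator scaleK A"
  shows "(hilbert_adjoint ip A ^^ n) (y - z) = (hilbert_adjoint ip A ^^ n) y - (hilbert_adjoint ip A ^^ n) z"
  by (rule ip_right_eqI)
    (simp add: ip_diff_right flip: ip_hilbert_adjoint_funpow[OF assms])

section \<open>Bessel sequences, frames and synthesis\<close>

text \<open>Bounding all finite sums makes square summability a consequence. The condition
  \<open>0 \<le> b\<close> is explicit because the zero space would not force it.\<close>

definition bessel :: "real \<Rightarrow> (nat \<Rightarrow> 'h) \<Rightarrow> bool" where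
  "bessel b x \<longleftrightarrow> 0 \<le> b \<and> (\<forall>f N. (\<Sum>n<N. (norm (ip f (x n)))\<^sup>2) \<le> b * (norm f)\<^sup>2)"

definition frame :: "real \<Rightarrow> real \<Rightarrow> (nat \<Rightarrow> 'h) \<Rightarrow> bool" where
  "frame a b x \<longleftrightarrow> 0 < a \<and> bessel b x \<and>
     (\<forall>f. a * (norm f)\<^sup>2 \<le> (ell2_norm (\<lambda>n. ip f (x n)))\<^sup>2)"

text \<open>For a Bessel sequence this is the adjoint of the analysis map
  \<open>f \<mapsto> (\<lambda>n. ip f (x n))\<close>; the series converges for
  \<open>c \<in> ell2\<close> by \<open>bessel_summable\<close>.\<close>

definition synthesis :: "(nat \<Rightarrow> 'h) \<Rightarrow> (nat \<Rightarrow> 'k) \<Rightarrow> 'h" where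
  "synthesis x c = (\<Sum>n. scaleK (c n) (x n))"

lemma besselD: "bessel b x \<Longrightarrow> (\<Sum>n<N. (norm (ip f (x n)))\<^sup>2) \<le> b * (norm f)\<^sup>2"
  by (simp add: bessel_def)

lemma bessel_analysis_mem_ell2:
  assumes "bessel b x"
  shows "(\<lambda>n. ip f (x n)) \<in> ell2"
  unfolding ell2_def mem_Collect_eq
  by (rule bounded_imp_summable[where B = "b * (norm f)\<^sup>2"])
    (use besselD[OF assms, where N = "Suc _"] in \<open>simp_all add: lessThan_Suc_atMost\<close>)

lemma bessel_analysis_norm_le:
  assumes "bessel b x"
  shows "(ell2_norm (\<lambda>n. ip f (x n)))\<^sup>2 \<le> b * (norm f)\<^sup>2"
proof -
  note mem = bessel_analysis_mem_ell2[OF assms, of f]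
  then have "summable (\<lambda>n. (norm (ip f (x n)))\<^sup>2)" by (simp add: ell2_def)
  from suminf_le_const[OF this besselD[OF assms]] show ?thesis
    by (simp add: power2_ell2_norm[OF mem])
qed

lemma norm_ip_sum_power2_le:
  "(norm (ip (\<Sum>n\<in>I. scaleK (c n) (x n)) f))\<^sup>2
    \<le> (\<Sum>n\<in>I. (norm (c n))\<^sup>2) * (\<Sum>n\<in>I. (norm (ip f (x n)))\<^sup>2)"
proof -
  have "norm (ip (\<Sum>n\<in>I. scaleK (c n) (x n)) f) \<le> (\<Sum>n\<in>I. norm (c n) * norm (ip f (x n)))"
    unfolding ip_sum_left
    by (rule order_trans[OF norm_sum]) (simp add: ip_scale_left norm_mult norm_ip_commute[of f])
  then have "(norm (ip (\<Sum>n\<in>I. scaleK (c n) (x n)) f))\<^sup>2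
      \<le> (\<Sum>n\<in>I. norm (c n) * norm (ip f (x n)))\<^sup>2"
    by (intro power_mono) simp_all
  also have "\<dots> \<le> (\<Sum>n\<in>I. (norm (c n))\<^sup>2) * (\<Sum>n\<in>I. (norm (ip f (x n)))\<^sup>2)"
    by (rule Cauchy_Schwarz_ineq_sum)
  finally show ?thesis .
qed

text \<open>Duality: pairing the combination \<open>v\<close> with itself bounds the fourth power of
  its norm by the right-hand side times its square, and the square cancels. General finite
  \<open>I\<close> covers the blocks in the Cauchy criterion.\<close>

lemma bessel_norm_sum_le:
  assumes "bessel b x" "finite I"
  shows "(norm (\<Sum>n\<in>I. scaleK (c n) (x n)))\<^sup>2 \<le> b * (\<Sum>n\<in>I. (norm (c n))\<^sup>2)"
proof (cases "(\<Sum>n\<in>I. scaleK (c n) (x n)) = 0")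
  case True
  with assms show ?thesis by (simp add: bessel_def sum_nonneg)
next
  case False
  define v where "v = (\<Sum>n\<in>I. scaleK (c n) (x n))"
  obtain N where N: "I \<subseteq> {..<N}"
    using assms(2) by (meson finite_nat_iff_bounded)
  have "(norm v)\<^sup>2 * (norm v)\<^sup>2 = (norm (ip v v))\<^sup>2"
    by (simp add: ip_self norm_power power2_eq_square norm_mult)
  also have "\<dots> \<le> (\<Sum>n\<in>I. (norm (c n))\<^sup>2) * (\<Sum>n\<in>I. (norm (ip v (x n)))\<^sup>2)"
    using norm_ip_sum_power2_le[of c x I v] by (simp add: v_def)
  also have "\<dots> \<le> (\<Sum>n\<in>I. (norm (c n))\<^sup>2) * (b * (norm v)\<^sup>2)"
  proof (rule mult_left_mono)
    have "(\<Sum>n\<in>I. (norm (ip v (x n)))\<^sup>2) \<le> (\<Sum>n<N. (norm (ip v (x n)))\<^sup>2)"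
      by (rule sum_mono2) (use N in auto)
    also have "\<dots> \<le> b * (norm v)\<^sup>2" by (rule besselD[OF assms(1)])
    finally show "(\<Sum>n\<in>I. (norm (ip v (x n)))\<^sup>2) \<le> b * (norm v)\<^sup>2" .
  qed (simp add: sum_nonneg)
  finally have "(norm v)\<^sup>2 * (norm v)\<^sup>2 \<le> (b * (\<Sum>n\<in>I. (norm (c n))\<^sup>2)) * (norm v)\<^sup>2"
    by (simp only: mult_ac)
  moreover have "0 < (norm v)\<^sup>2" using False by (simp add: v_def)
  ultimately show ?thesis
    unfolding v_def[symmetric] by (rule mult_right_le_imp_le)
qed

text \<open>The converse duality: with \<open>c n = ip f (x n)\<close>, pairing the combination with
  \<open>f\<close> gives the coefficient sum \<open>s\<close>. Cauchy-Schwarz then bounds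
  \<open>s * s\<close> by a multiple of \<open>s\<close>.\<close>

lemma besselI:
  assumes "0 \<le> b"
    and le: "\<And>(c :: nat \<Rightarrow> 'k) N.
      (norm (\<Sum>n<N. scaleK (c n) (x n)))\<^sup>2 \<le> b * (\<Sum>n<N. (norm (c n))\<^sup>2)"
  shows "bessel b x"
  unfolding bessel_def
proof (intro conjI allI)
  fix f N
  define c where "c n = ip f (x n)" for n
  define s where "s = (\<Sum>n<N. (norm (c n))\<^sup>2)"
  have "ip (\<Sum>n<N. scaleK (c n) (x n)) f = (\<Sum>n<N. of_real ((norm (c n))\<^sup>2))"
    unfolding ip_sum_left ip_scale_left
    by (intro sum.cong refl) (metis mult_conjugate_of_real ip_commute c_def)
  then have "ip (\<Sum>n<N. scaleK (c n) (x n)) f = of_real s"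
    by (simp add: s_def)
  moreover have s0: "0 \<le> s" by (simp add: s_def sum_nonneg)
  ultimately have "s \<le> norm (\<Sum>n<N. scaleK (c n) (x n)) * norm f"
    using norm_ip_le[of "\<Sum>n<N. scaleK (c n) (x n)" f] by simp
  then have "s\<^sup>2 \<le> (norm (\<Sum>n<N. scaleK (c n) (x n)) * norm f)\<^sup>2"
    using s0 by (rule power_mono)
  also have "\<dots> \<le> (b * s) * (norm f)\<^sup>2"
    unfolding power_mult_distrib s_def by (intro mult_right_mono le) simp
  finally have "s * s \<le> (b * (norm f)\<^sup>2) * s"
    by (simp add: power2_eq_square mult_ac)
  then have "s \<le> b * (norm f)\<^sup>2"
    using s0 assms(1) by (cases "s = 0") (auto dest: mult_right_le_imp_le)
  then show "(\<Sum>n<N. (norm (ip f (x n)))\<^sup>2) \<le> b * (norm f)\<^sup>2"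
    by (simp add: s_def c_def)
qed (rule assms(1))

lemma bessel_summable:
  assumes "bessel b x" "c \<in> ell2"
  shows "summable (\<lambda>n. scaleK (c n) (x n))"
  unfolding summable_Cauchy
proof (intro allI impI)
  fix e :: real assume e: "0 < e"
  have b: "0 \<le> b" using assms(1) by (simp add: bessel_def)
  \<comment> \<open>Dividing by \<open>b + 1\<close> also covers \<open>b = 0\<close>.\<close>
  have "0 < e\<^sup>2 / (b + 1)" using e b by simp
  with assms(2) obtain N
    where N: "\<And>m n. N \<le> m \<Longrightarrow> norm (\<Sum>k=m..<n. (norm (c k))\<^sup>2) < e\<^sup>2 / (b + 1)"
    unfolding ell2_def mem_Collect_eq summable_Cauchy by blast
  show "\<exists>N. \<forall>m\<ge>N. \<forall>n. norm (\<Sum>k=m..<n. scaleK (c k) (x k)) < e"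
  proof (intro exI allI impI)
    fix m n assume m: "N \<le> m"
    define t where "t = (\<Sum>k=m..<n. (norm (c k))\<^sup>2)"
    have t0: "0 \<le> t" by (simp add: t_def sum_nonneg)
    have "t * (b + 1) < e\<^sup>2"
      using N[OF m, of n] t0 b by (simp add: t_def[symmetric] pos_less_divide_eq)
    moreover have "(norm (\<Sum>k=m..<n. scaleK (c k) (x k)))\<^sup>2 \<le> b * t"
      unfolding t_def by (rule bessel_norm_sum_le[OF assms(1)]) simp
    ultimately have "(norm (\<Sum>k=m..<n. scaleK (c k) (x k)))\<^sup>2 < e\<^sup>2"
      using t0 by (simp add: algebra_simps)
    then show "norm (\<Sum>k=m..<n. scaleK (c k) (x k)) < e"
      using e by (simp add: power2_less_imp_less)
  qed
qed

lemma synthesis_LIMSEQ: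
  assumes "bessel b x" "c \<in> ell2"
  shows "(\<lambda>N. \<Sum>n<N. scaleK (c n) (x n)) \<longlonglongrightarrow> synthesis x c"
  unfolding synthesis_def by (rule summable_LIMSEQ[OF bessel_summable[OF assms]])

lemma synthesis_add:
  assumes "bessel b x" "c \<in> ell2" "d \<in> ell2"
  shows "synthesis x (\<lambda>n. c n + d n) = synthesis x c + synthesis x d"
  unfolding synthesis_def scale_left_distrib
  by (rule suminf_add[symmetric]) (use assms bessel_summable in blast)+

lemma synthesis_scale:
  assumes "bessel b x" "c \<in> ell2"
  shows "synthesis x (\<lambda>n. k * c n) = scaleK k (synthesis x c)"
  unfolding synthesis_def scale_scale[symmetric]
  by (rule bounded_linear.suminf[OF bounded_linear_scaleK bessel_summable[OF assms], symmetric])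

lemma norm_synthesis_le:
  assumes "bessel b x" "c \<in> ell2"
  shows "(norm (synthesis x c))\<^sup>2 \<le> b * (ell2_norm c)\<^sup>2"
proof (rule LIMSEQ_le_const2)
  show "(\<lambda>N. (norm (\<Sum>n<N. scaleK (c n) (x n)))\<^sup>2) \<longlonglongrightarrow> (norm (synthesis x c))\<^sup>2"
    by (intro tendsto_intros synthesis_LIMSEQ[OF assms])
  have "(norm (\<Sum>n<N. scaleK (c n) (x n)))\<^sup>2 \<le> b * (ell2_norm c)\<^sup>2" for N
  proof -
    have "(norm (\<Sum>n<N. scaleK (c n) (x n)))\<^sup>2 \<le> b * (\<Sum>n<N. (norm (c n))\<^sup>2)"
      by (rule bessel_norm_sum_le[OF assms(1)]) simp
    also have "\<dots> \<le> b * (ell2_norm c)\<^sup>2"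
      using assms by (intro mult_left_mono sum_le_ell2_norm) (simp_all add: bessel_def)
    finally show ?thesis .
  qed
  then show "\<exists>M. \<forall>N\<ge>M. (norm (\<Sum>n<N. scaleK (c n) (x n)))\<^sup>2 \<le> b * (ell2_norm c)\<^sup>2"
    by blast
qed

lemma norm_ip_synthesis_le:
  assumes "bessel b x" "c \<in> ell2"
  shows "(norm (ip (synthesis x c) f))\<^sup>2 \<le> (ell2_norm c)\<^sup>2 * (ell2_norm (\<lambda>n. ip f (x n)))\<^sup>2"
proof (rule LIMSEQ_le_const2)
  show "(\<lambda>N. (norm (ip (\<Sum>n<N. scaleK (c n) (x n)) f))\<^sup>2) \<longlonglongrightarrow> (norm (ip (synthesis x c) f))\<^sup>2"
    by (intro tendsto_intros bounded_linear.tendsto[OF bounded_linear_ip] synthesis_LIMSEQ[OF assms])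
  have "(norm (ip (\<Sum>n<N. scaleK (c n) (x n)) f))\<^sup>2
      \<le> (ell2_norm c)\<^sup>2 * (ell2_norm (\<lambda>n. ip f (x n)))\<^sup>2" for N
    by (rule order_trans[OF norm_ip_sum_power2_le])
      (intro mult_mono sum_le_ell2_norm assms bessel_analysis_mem_ell2[OF assms(1)]; simp add: sum_nonneg)
  then show "\<exists>M. \<forall>N\<ge>M. (norm (ip (\<Sum>n<N. scaleK (c n) (x n)) f))\<^sup>2
      \<le> (ell2_norm c)\<^sup>2 * (ell2_norm (\<lambda>n. ip f (x n)))\<^sup>2"
    by blast
qed

text \<open>The quadratic form of the frame operator is real, and the lower frame bound becomes its
  coercivity.\<close>

lemma ip_synthesis_analysis:
  assumes "bessel b x"
  shows "ip (synthesis x (\<lambda>n. ip f (x n))) f = of_real ((ell2_norm (\<lambda>n. ip f (x n)))\<^sup>2)"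
proof -
  note mem = bessel_analysis_mem_ell2[OF assms, of f]
  then have sm: "summable (\<lambda>n. (norm (ip f (x n)))\<^sup>2)" by (simp add: ell2_def)
  have eq: "ip (scaleK (ip f (x n)) (x n)) f = of_real ((norm (ip f (x n)))\<^sup>2)" for n
    unfolding ip_scale_left ip_commute[of "x n" f] by (rule mult_conjugate_of_real)
  have "ip (synthesis x (\<lambda>n. ip f (x n))) f = (\<Sum>n. ip (scaleK (ip f (x n)) (x n)) f)"
    unfolding synthesis_def
    by (rule bounded_linear.suminf[OF bounded_linear_ip bessel_summable[OF assms mem]])
  also have "\<dots> = of_real (\<Sum>n. (norm (ip f (x n)))\<^sup>2)"
    unfolding eq by (rule bounded_linear.suminf[OF bounded_linear_of_real sm, symmetric])
  finally show ?thesis by (simp only: power2_ell2_norm[OF mem])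
qed

section \<open>Inversion of the frame operator\<close>

text \<open>
  For \<open>t = a / b\<^sup>2\<close> the map \<open>f \<mapsto> f - t S f + t y\<close> contracts with factor \<open>sqrt (1 - a\<^sup>2 / b\<^sup>2)\<close>; its
  fixed point solves \<open>S f = y\<close>.
\<close>

lemma coercive_imp_invertible:
  fixes S :: "'h \<Rightarrow> 'h"
  assumes add: "\<And>x y. S (x + y) = S x + S y"
    and scale: "\<And>c x. S (scaleK c x) = scaleK c (S x)"
    and a: "0 < a" and ab: "a \<le> b"
    and bound: "\<And>x. norm (S x) \<le> b * norm x"
    and coercive: "\<And>x. \<exists>r. ip (S x) x = of_real r \<and> a * (norm x)\<^sup>2 \<le> r"
  shows "\<exists>T. (\<forall>x. S (T x) = x) \<and> (\<forall>x. T (S x) = x) \<and> (\<forall>x y. T (x + y) = T x + T y) \<and>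
    (\<forall>c x. T (scaleK c x) = scaleK c (T x)) \<and> (\<forall>x. norm (T x) \<le> norm x / a)"
proof -
  \<comment> \<open>Coercivity and Cauchy-Schwarz bound \<open>S\<close> from below. This yields
    both injectivity and the norm bound on the inverse.\<close>
  have lower: "a * norm x \<le> norm (S x)" for x
  proof (cases "x = 0")
    case False
    obtain r where r: "ip (S x) x = of_real r" "a * (norm x)\<^sup>2 \<le> r"
      using coercive by blast
    have "(a * norm x) * norm x \<le> norm (S x) * norm x"
      using norm_ip_le[of "S x" x] r by (simp add: power2_eq_square mult_ac)
    with False show ?thesis by simp
  qed simp
  have diff: "S (x - y) = S x - S y" for x y
    using add[of x "scaleK (- 1) y"] scale[of "- 1" y] by simp
  have inj: "x = y" if "S x = S y" for x y
    using lower[of "x - y"] that a by (simp add: diff mult_le_0_iff)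
  have "\<exists>x. S x = y" for y
  proof -
    define t where "t = a / b\<^sup>2"
    define q where "q = 1 - a\<^sup>2 / b\<^sup>2"
    have b: "0 < b" using a ab by simp
    have t: "0 < t" using a b by (simp add: t_def)
    have q0: "0 \<le> q" using a ab b by (simp add: q_def power_mono)
    have q1: "q < 1" using a b by (simp add: q_def)
    define F where "F x = x - t *\<^sub>R S x + t *\<^sub>R y" for x
    \<comment> \<open>Expanding the square gives the factor
      \<open>t\<^sup>2 * b\<^sup>2 + 1 - 2 * t * a\<close>; the chosen \<open>t\<close> minimises
      it, with value \<open>q\<close>.\<close>
    have contr: "(norm (z - t *\<^sub>R S z))\<^sup>2 \<le> q * (norm z)\<^sup>2" for z
    proof -
      obtain r where r: "ip (S z) z = of_real r" "a * (norm z)\<^sup>2 \<le> r"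
        using coercive by blast
      have "ip (- (t *\<^sub>R S z)) z = of_real (- (t * r))"
        using r(1) by (simp add: ip_minus_left ip_scale_left flip: scale_of_real)
      then have "(norm (- (t *\<^sub>R S z) + z))\<^sup>2
          = (norm (- (t *\<^sub>R S z)))\<^sup>2 + (norm z)\<^sup>2 + 2 * (- (t * r))"
        by (rule norm_add_power2)
      then have "(norm (z - t *\<^sub>R S z))\<^sup>2 = t\<^sup>2 * (norm (S z))\<^sup>2 + (norm z)\<^sup>2 - 2 * (t * r)"
        by (simp add: power_mult_distrib)
      also have "\<dots> \<le> t\<^sup>2 * (b * norm z)\<^sup>2 + (norm z)\<^sup>2 - 2 * (t * (a * (norm z)\<^sup>2))"
        using t r(2) bound[of z]
        by (intro diff_mono add_mono mult_left_mono power_mono order_refl) simp_all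
      also have "\<dots> = (t\<^sup>2 * b\<^sup>2 + 1 - 2 * t * a) * (norm z)\<^sup>2"
        by (simp add: algebra_simps)
      also have "t\<^sup>2 * b\<^sup>2 + 1 - 2 * t * a = q"
        using b by (simp add: t_def q_def field_simps power2_eq_square)
      finally show ?thesis .
    qed
    have "\<exists>!x. F x = x"
    proof (rule banach_fix_type)
      show "0 \<le> sqrt q" using q0 by simp
      show "sqrt q < 1" using q1 by simp
      show "\<forall>x z. dist (F x) (F z) \<le> sqrt q * dist x z"
      proof (intro allI)
        fix x z
        have "F x - F z = (x - z) - t *\<^sub>R S (x - z)"
          by (simp add: F_def diff scaleR_diff_right)
        then have "(dist (F x) (F z))\<^sup>2 \<le> (sqrt q * dist x z)\<^sup>2"
          using contr[of "x - z"] q0 by (simp add: dist_norm power_mult_distrib)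
        then show "dist (F x) (F z) \<le> sqrt q * dist x z"
          by (rule power2_le_imp_le) (use q0 in simp)
      qed
    qed
    then obtain x where "F x = x" by blast
    then have "t *\<^sub>R S x = t *\<^sub>R y" by (auto simp: F_def)
    with t show ?thesis by auto
  qed
  then obtain T where T: "\<And>y. S (T y) = y" by metis
  show ?thesis
  proof (intro exI[of _ T] conjI allI)
    show "norm (T x) \<le> norm x / a" for x
      using lower[of "T x"] a by (simp add: T pos_le_divide_eq mult.commute)
  \<comment> \<open>Each remaining law of \<open>T\<close> holds after applying \<open>S\<close> to
    both sides, hence by injectivity of \<open>S\<close>.\<close>
  qed (rule T inj; simp add: T add scale)+
qed

text \<open>Both orders of composition matter: inverting after synthesis recovers \<open>f\<close>
  from its coefficients, while inverting first writes \<open>f\<close> as a series in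
  \<open>x\<close> with controlled coefficients.\<close>

lemma frame_operator_inverse:
  assumes "frame a b x"
  shows "\<exists>T K. 0 \<le> K \<and> (\<forall>f. synthesis x (\<lambda>n. ip (T f) (x n)) = f) \<and>
    (\<forall>f. T (synthesis x (\<lambda>n. ip f (x n))) = f) \<and> (\<forall>f g. T (f + g) = T f + T g) \<and>
    (\<forall>c f. T (scaleK c f) = scaleK c (T f)) \<and> (\<forall>f. norm (T f) \<le> K * norm f)"
proof -
  define S where "S f = synthesis x (\<lambda>n. ip f (x n))" for f
  from assms have a: "0 < a" and bessel: "bessel b x"
    and lower: "\<And>f. a * (norm f)\<^sup>2 \<le> (ell2_norm (\<lambda>n. ip f (x n)))\<^sup>2"
    by (auto simp: frame_def)
  note mem = bessel_analysis_mem_ell2[OF bessel]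
  have b: "0 \<le> b" using bessel by (simp add: bessel_def)
  have "\<exists>T. (\<forall>f. S (T f) = f) \<and> (\<forall>f. T (S f) = f) \<and> (\<forall>f g. T (f + g) = T f + T g) \<and>
    (\<forall>c f. T (scaleK c f) = scaleK c (T f)) \<and> (\<forall>f. norm (T f) \<le> norm f / a)"
  \<comment> \<open>In the zero space \<open>b\<close> may be smaller than \<open>a\<close>, so the
    maximum serves as upper bound.\<close>
  proof (rule coercive_imp_invertible[where b = "max a b"])
    show "S (f + g) = S f + S g" for f g
      unfolding S_def ip_add_left by (rule synthesis_add[OF bessel mem mem])
    show "S (scaleK c f) = scaleK c (S f)" for c f
      unfolding S_def ip_scale_left by (rule synthesis_scale[OF bessel mem])
    show "norm (S f) \<le> max a b * norm f" for f
    proof -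
      have "(norm (S f))\<^sup>2 \<le> b * (ell2_norm (\<lambda>n. ip f (x n)))\<^sup>2"
        unfolding S_def by (rule norm_synthesis_le[OF bessel mem])
      also have "\<dots> \<le> b * (b * (norm f)\<^sup>2)"
        by (intro mult_left_mono bessel_analysis_norm_le bessel b)
      finally have "(norm (S f))\<^sup>2 \<le> (b * norm f)\<^sup>2"
        by (simp add: power2_eq_square mult_ac)
      then have "norm (S f) \<le> b * norm f"
        by (rule power2_le_imp_le) (simp add: b)
      also have "\<dots> \<le> max a b * norm f" by (intro mult_right_mono) simp_all
      finally show ?thesis .
    qed
    show "\<exists>r. ip (S f) f = of_real r \<and> a * (norm f)\<^sup>2 \<le> r" for f
      using ip_synthesis_analysis[OF bessel, of f] lower[of f] unfolding S_def by blast
  qed (use a in auto)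
  then obtain T where "\<And>f. S (T f) = f" "\<And>f. T (S f) = f" "\<And>f g. T (f + g) = T f + T g"
    "\<And>c f. T (scaleK c f) = scaleK c (T f)" "\<And>f. norm (T f) \<le> 1 / a * norm f"
    by auto
  with a show ?thesis unfolding S_def by (intro exI[of _ T] exI[of _ "1 / a"]) simp
qed

section \<open>Stable recovery and frames\<close>

text \<open>The uniform boundedness principle for the family of partial sums, via Baire's theorem.\<close>

lemma analysis_mem_ell2_imp_bessel:
  assumes mem: "\<And>f. (\<lambda>n. ip f (x n)) \<in> ell2"
  shows "\<exists>b. bessel b x"
proof -
  define p where "p f N = (\<Sum>n<N. (norm (ip f (x n)))\<^sup>2)" for f N
  define E where "E k = {f. \<forall>N. p f N \<le> real k}" for k
  have "closed (E k)" for k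
  proof -
    have "continuous_on UNIV (\<lambda>f. p f N)" for N
      unfolding p_def
      by (intro continuous_intros bounded_linear.continuous_on[OF bounded_linear_ip])
    then have "closed {f. p f N \<le> real k}" for N
      by (intro closed_Collect_le continuous_intros)
    moreover have "E k = (\<Inter>N. {f. p f N \<le> real k})" by (auto simp: E_def)
    ultimately show ?thesis by auto
  qed
  moreover have "\<Union> (range E) = UNIV"
  proof -
    have "f \<in> E (nat \<lceil>(ell2_norm (\<lambda>n. ip f (x n)))\<^sup>2\<rceil>)" for f
      unfolding E_def p_def using sum_le_ell2_norm[OF mem[of f]] real_nat_ceiling_ge order_trans
      by blast
    then show ?thesis by blast
  qed
  ultimately have "\<exists>k. interior (E k) \<noteq> {}"
    using Baire_category_alt[of "euclidean :: 'h topology" "range E"]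
    by (auto simp: completely_metrizable_space_euclidean)
  then obtain k f0 where "f0 \<in> interior (E k)" by blast
  then obtain r where r: "0 < r" "cball f0 r \<subseteq> E k"
    using mem_interior_cball by blast
  \<comment> \<open>\<open>u\<close> is the difference of \<open>f0 + u\<close> and
    \<open>f0\<close>, both in \<open>E k\<close>. Squaring the sum of two norms costs a factor 2 on
    each square, hence \<open>4 * real k\<close>.\<close>
  have ball: "p u N \<le> 4 * real k" if "norm u \<le> r" for u N
  proof -
    have "p u N \<le> 2 * p (f0 + u) N + 2 * p f0 N"
      unfolding p_def sum_distrib_left sum.distrib[symmetric]
    proof (rule sum_mono)
      fix n
      have "norm (ip u (x n)) \<le> norm (ip (f0 + u) (x n)) + norm (ip f0 (x n))"
        using norm_triangle_ineq4[of "ip (f0 + u) (x n)" "ip f0 (x n)"] by (simp add: ip_add_left)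
      then have "(norm (ip u (x n)))\<^sup>2 \<le> (norm (ip (f0 + u) (x n)) + norm (ip f0 (x n)))\<^sup>2"
        by (rule power_mono) simp
      also have "\<dots> \<le> 2 * (norm (ip (f0 + u) (x n)))\<^sup>2 + 2 * (norm (ip f0 (x n)))\<^sup>2"
        using zero_le_power2[of "norm (ip (f0 + u) (x n)) - norm (ip f0 (x n))"]
        by (simp add: power2_sum power2_diff)
      finally show "(norm (ip u (x n)))\<^sup>2
          \<le> 2 * (norm (ip (f0 + u) (x n)))\<^sup>2 + 2 * (norm (ip f0 (x n)))\<^sup>2" .
    qed
    moreover have "f0 + u \<in> E k" "f0 \<in> E k"
      using r that by (auto simp: subset_iff dist_norm)
    then have "p (f0 + u) N \<le> real k" "p f0 N \<le> real k" by (auto simp: E_def)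
    ultimately show ?thesis by simp
  qed
  have "bessel (4 * real k / r\<^sup>2) x"
    unfolding bessel_def
  proof (intro conjI allI)
    fix f N
    show "(\<Sum>n<N. (norm (ip f (x n)))\<^sup>2) \<le> 4 * real k / r\<^sup>2 * (norm f)\<^sup>2"
    proof (cases "f = 0")
      case False
      \<comment> \<open>Rescaling \<open>f\<close> to norm \<open>r\<close> brings it into the ball,
        and \<open>p\<close> scales quadratically.\<close>
      define s where "s = r / norm f"
      have s: "0 < s" using r False by (simp add: s_def)
      have "p (scaleK (of_real s) f) N = s\<^sup>2 * p f N"
        by (simp add: p_def ip_scale_left norm_mult power_mult_distrib sum_distrib_left)
      moreover have "norm (scaleK (of_real s) f) \<le> r"
        using r False by (simp add: norm_scaleK s_def norm_divide)
      ultimately have "s\<^sup>2 * p f N \<le> 4 * real k"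
        using ball by metis
      then have "p f N \<le> 4 * real k / s\<^sup>2"
        using s by (simp add: pos_le_divide_eq mult.commute)
      also have "\<dots> = 4 * real k / r\<^sup>2 * (norm f)\<^sup>2"
        by (simp add: s_def power_divide)
      finally show ?thesis by (simp add: p_def)
    qed simp
  qed simp
  then show ?thesis by blast
qed

text \<open>The lower bound comes from the boundedness of the recovery operator applied to the
  coefficients of \<open>f\<close>.\<close>

lemma stably_recoverable_imp_frame:
  assumes A: "bounded_operator scaleK A" and rec: "stably_recoverable scaleK ip A u"
  shows "\<exists>a b. frame a b (\<lambda>n. (hilbert_adjoint ip A ^^ n) u)"
proof -
  define x where "x n = (hilbert_adjoint ip A ^^ n) u" for n
  have samples: "samples ip A u f = (\<lambda>n. ip f (x n))" for f
    by (simp add: samples_def x_def ip_hilbert_adjoint_funpow[OF A])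
  from rec obtain R where mem: "\<And>f. (\<lambda>n. ip f (x n)) \<in> ell2"
    and R: "bounded_linear_on_ell2 scaleK R" and inv: "\<And>f. R (\<lambda>n. ip f (x n)) = f"
    unfolding stably_recoverable_def samples by blast
  from R obtain M where M: "\<And>c. c \<in> ell2 \<Longrightarrow> norm (R c) \<le> M * ell2_norm c"
    unfolding bounded_linear_on_ell2_def by blast
  obtain b where b: "bessel b x"
    using analysis_mem_ell2_imp_bessel[of x] mem by blast
  \<comment> \<open>\<open>M\<close> may be zero if the space is trivial; adding 1 keeps the
    denominator positive.\<close>
  have "1 / (M\<^sup>2 + 1) * (norm f)\<^sup>2 \<le> (ell2_norm (\<lambda>n. ip f (x n)))\<^sup>2" for f
  proof -
    have "norm f \<le> M * ell2_norm (\<lambda>n. ip f (x n))"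
      using M[OF mem[of f]] by (simp add: inv)
    then have "(norm f)\<^sup>2 \<le> M\<^sup>2 * (ell2_norm (\<lambda>n. ip f (x n)))\<^sup>2"
      using power_mono[of "norm f" _ 2] by (simp flip: power_mult_distrib)
    also have "\<dots> \<le> (M\<^sup>2 + 1) * (ell2_norm (\<lambda>n. ip f (x n)))\<^sup>2"
      by (intro mult_right_mono) simp_all
    finally show ?thesis
      by (simp add: divide_le_eq mult.commute add_nonneg_pos)
  qed
  with b have "frame (1 / (M\<^sup>2 + 1)) b x"
    by (simp add: frame_def add_nonneg_pos)
  then show ?thesis unfolding x_def by blast
qed

lemma frame_imp_stably_recoverable:
  assumes A: "bounded_operator scaleK A"
    and frame: "frame a b (\<lambda>n. (hilbert_adjoint ip A ^^ n) u)"
  shows "stably_recoverable scaleK ip A u"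
proof -
  define x where "x n = (hilbert_adjoint ip A ^^ n) u" for n
  have samples: "samples ip A u f = (\<lambda>n. ip f (x n))" for f
    by (simp add: samples_def x_def ip_hilbert_adjoint_funpow[OF A])
  have frame: "frame a b x" using frame by (simp add: x_def[abs_def])
  then have bessel: "bessel b x" by (simp add: frame_def)
  then have b: "0 \<le> b" by (simp add: bessel_def)
  from frame_operator_inverse[OF frame] obtain T K where K: "0 \<le> K"
    and inv: "\<And>f. T (synthesis x (\<lambda>n. ip f (x n))) = f"
    and T: "\<And>f g. T (f + g) = T f + T g" "\<And>c f. T (scaleK c f) = scaleK c (T f)"
    and bound: "\<And>f. norm (T f) \<le> K * norm f"
    by blast
  have "norm (T (synthesis x c)) \<le> (K * sqrt b) * ell2_norm c" if c: "c \<in> ell2" for c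
  proof -
    have "norm (synthesis x c) \<le> sqrt (b * (ell2_norm c)\<^sup>2)"
      by (rule real_le_rsqrt[OF norm_synthesis_le[OF bessel c]])
    also have "\<dots> = sqrt b * ell2_norm c"
      using c by (simp add: real_sqrt_mult ell2_norm_def ell2_def suminf_nonneg)
    finally have "K * norm (synthesis x c) \<le> K * (sqrt b * ell2_norm c)"
      using K by (rule mult_left_mono)
    with bound[of "synthesis x c"] show ?thesis by simp
  qed
  then have "bounded_linear_on_ell2 scaleK (\<lambda>c. T (synthesis x c))"
    unfolding bounded_linear_on_ell2_def
    by (auto simp: synthesis_add[OF bessel] synthesis_scale[OF bessel] T)
  then show ?thesis
    unfolding stably_recoverable_def samples
    using bessel_analysis_mem_ell2[OF bessel] inv by blast
qed

section \<open>Stability of frames under perturbation\<close>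

text \<open>\<open>q < 1\<close> allows the combinations of \<open>y\<close> to be bounded by those
  of \<open>x\<close>, and later lets the square of \<open>norm v\<close> be discarded;
  \<open>p < 1\<close> leaves a positive multiple of the square of \<open>norm f\<close>.\<close>

lemma frame_perturbation:
  fixes x y :: "nat \<Rightarrow> 'h"
  assumes frame: "frame a b x"
    and p: "0 \<le> p" "p < 1" and q: "0 \<le> q" "q < 1"
    and le: "\<And>N (c :: nat \<Rightarrow> 'k).
      (norm ((\<Sum>n<N. scaleK (c n) (x n)) - (\<Sum>n<N. scaleK (c n) (y n))))\<^sup>2
      \<le> p * (norm (\<Sum>n<N. scaleK (c n) (x n)))\<^sup>2 + q * (norm (\<Sum>n<N. scaleK (c n) (y n)))\<^sup>2"
  shows "\<exists>a' b'. frame a' b' y"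
proof -
  have bx: "bessel b x" using frame by (simp add: frame_def)
  then have b: "0 \<le> b" by (simp add: bessel_def)
  \<comment> \<open>This solves
    \<open>norm v \<le> norm u + sqrt p * norm u + sqrt q * norm v\<close> for
    \<open>norm v\<close>.\<close>
  define k where "k = (1 + sqrt p) / (1 - sqrt q)"
  have sq: "sqrt q < 1" using q by simp
  have k: "0 \<le> k" using p sq by (simp add: k_def)
  have norm_le: "norm v \<le> k * norm u"
    if "(norm (u - v))\<^sup>2 \<le> p * (norm u)\<^sup>2 + q * (norm v)\<^sup>2" for u v :: 'h
  proof -
    have "norm (u - v) \<le> sqrt (p * (norm u)\<^sup>2 + q * (norm v)\<^sup>2)"
      by (rule real_le_rsqrt[OF that])
    also have "\<dots> \<le> sqrt p * norm u + sqrt q * norm v"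
      using sqrt_add_le_add_sqrt[of "p * (norm u)\<^sup>2" "q * (norm v)\<^sup>2"] p q
      by (simp add: real_sqrt_mult)
    finally have "norm v \<le> norm u + (sqrt p * norm u + sqrt q * norm v)"
      using norm_triangle_ineq4[of u "u - v"] by simp
    then have "norm v * (1 - sqrt q) \<le> (1 + sqrt p) * norm u"
      by (simp add: algebra_simps)
    with sq show ?thesis by (simp add: k_def pos_le_divide_eq)
  qed
  have bes_y: "bessel (k\<^sup>2 * b) y"
  proof (rule besselI)
    fix c :: "nat \<Rightarrow> 'k" and N
    have "(norm (\<Sum>n<N. scaleK (c n) (y n)))\<^sup>2 \<le> (k * norm (\<Sum>n<N. scaleK (c n) (x n)))\<^sup>2"
      by (intro power_mono norm_le le) simp
    also have "\<dots> \<le> k\<^sup>2 * (b * (\<Sum>n<N. (norm (c n))\<^sup>2))"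
      unfolding power_mult_distrib by (intro mult_left_mono bessel_norm_sum_le bx) simp_all
    finally show "(norm (\<Sum>n<N. scaleK (c n) (y n)))\<^sup>2 \<le> k\<^sup>2 * b * (\<Sum>n<N. (norm (c n))\<^sup>2)"
      by (simp add: mult.assoc)
  qed (use b in simp)
  \<comment> \<open>With the Bessel bound for \<open>y\<close> available, both series converge and
    the estimate for finite sums passes to the limit.\<close>
  have limit: "(norm (synthesis x c - synthesis y c))\<^sup>2
      \<le> p * (norm (synthesis x c))\<^sup>2 + q * (norm (synthesis y c))\<^sup>2" if c: "c \<in> ell2" for c
  proof (rule LIMSEQ_le)
    show "(\<lambda>N. (norm ((\<Sum>n<N. scaleK (c n) (x n)) - (\<Sum>n<N. scaleK (c n) (y n))))\<^sup>2)
        \<longlonglongrightarrow> (norm (synthesis x c - synthesis y c))\<^sup>2"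
      by (intro tendsto_intros synthesis_LIMSEQ[OF bx c] synthesis_LIMSEQ[OF bes_y c])
    show "(\<lambda>N. p * (norm (\<Sum>n<N. scaleK (c n) (x n)))\<^sup>2 + q * (norm (\<Sum>n<N. scaleK (c n) (y n)))\<^sup>2)
        \<longlonglongrightarrow> p * (norm (synthesis x c))\<^sup>2 + q * (norm (synthesis y c))\<^sup>2"
      by (intro tendsto_intros synthesis_LIMSEQ[OF bx c] synthesis_LIMSEQ[OF bes_y c])
  qed (use le in blast)
  from frame_operator_inverse[OF frame] obtain T K
    where T: "\<And>f. synthesis x (\<lambda>n. ip (T f) (x n)) = f"
    and TK: "\<And>f. norm (T f) \<le> K * norm f"
    by blast
  \<comment> \<open>Squaring the estimate of \<open>norm f\<close> by
    \<open>2 * norm (ip v f)\<close> produces the factor \<open>4 * b * K\<^sup>2\<close>; the added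
    1 makes \<open>C\<close> a positive divisor.\<close>
  define C where "C = 4 * b * K\<^sup>2 + 1"
  have C: "0 < C" using b by (simp add: C_def add_nonneg_pos)
  have "(1 - p)\<^sup>2 / C * (norm f)\<^sup>2 \<le> (ell2_norm (\<lambda>n. ip f (y n)))\<^sup>2" for f
  proof (cases "f = 0")
    case False
    define c where "c n = ip (T f) (x n)" for n
    define v where "v = synthesis y c"
    define s where "s = (ell2_norm (\<lambda>n. ip f (y n)))\<^sup>2"
    have s: "0 \<le> s" by (simp add: s_def)
    have c: "c \<in> ell2"
      unfolding c_def by (rule bessel_analysis_mem_ell2[OF bx])
    have xc: "synthesis x c = f"
      using T by (simp add: c_def[abs_def])
    have "(ell2_norm c)\<^sup>2 \<le> b * (norm (T f))\<^sup>2"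
      unfolding c_def by (rule bessel_analysis_norm_le[OF bx])
    also have "\<dots> \<le> b * (K * norm f)\<^sup>2"
      by (intro mult_left_mono power_mono TK b) simp
    finally have cn: "(ell2_norm c)\<^sup>2 \<le> b * (K * norm f)\<^sup>2" .
    have ipv: "(norm (ip v f))\<^sup>2 \<le> b * (K * norm f)\<^sup>2 * s"
      using norm_ip_synthesis_le[OF bes_y c, of f] mult_right_mono[OF cn s]
      by (simp add: v_def s_def)
    have "(norm f)\<^sup>2 + (norm v)\<^sup>2 - 2 * norm (ip v f) \<le> p * (norm f)\<^sup>2 + q * (norm v)\<^sup>2"
      using norm_diff_power2_ge[of f v] limit[OF c]
      by (simp add: xc v_def norm_ip_commute[of f])
    \<comment> \<open>The size of \<open>v\<close> is unknown, but its square on the left absorbs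
      the one on the right.\<close>
    moreover have "q * (norm v)\<^sup>2 \<le> (norm v)\<^sup>2"
      using q by (simp add: mult_left_le_one_le)
    ultimately have "(1 - p) * (norm f)\<^sup>2 \<le> 2 * norm (ip v f)"
      by (simp add: algebra_simps)
    then have "((1 - p) * (norm f)\<^sup>2)\<^sup>2 \<le> (2 * norm (ip v f))\<^sup>2"
      by (rule power_mono) (use p in simp)
    also have "\<dots> \<le> 4 * (b * (K * norm f)\<^sup>2 * s)"
      using ipv by (simp add: power_mult_distrib)
    also have "\<dots> = (4 * b * K\<^sup>2) * ((norm f)\<^sup>2 * s)"
      by (simp add: power_mult_distrib mult_ac)
    also have "\<dots> \<le> C * ((norm f)\<^sup>2 * s)"
      using s by (intro mult_right_mono) (simp_all add: C_def)
    finally have "((1 - p)\<^sup>2 * (norm f)\<^sup>2) * (norm f)\<^sup>2 \<le> (C * s) * (norm f)\<^sup>2"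
      by (simp add: power_mult_distrib power2_eq_square mult_ac)
    then have "(1 - p)\<^sup>2 * (norm f)\<^sup>2 \<le> C * s"
      by (rule mult_right_le_imp_le) (use False in simp)
    with C show ?thesis by (simp add: s_def pos_divide_le_eq mult.commute)
  qed simp
  with C p bes_y have "frame ((1 - p)\<^sup>2 / C) (k\<^sup>2 * b) y"
    by (simp add: frame_def)
  then show ?thesis by blast
qed

end

section \<open>Application to the adjoint orbits of \<open>g\<close> and \<open>h\<close>\<close>

theorem theorem3p1:
  fixes scaleK :: "'k::real_or_complex \<Rightarrow> 'h::banach \<Rightarrow> 'h"
    and ip :: "'h \<Rightarrow> 'h \<Rightarrow> 'k"
    and A :: "'h \<Rightarrow> 'h"
    and g h :: 'h
    and lam \<mu> \<nu> \<epsilon> :: real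
  assumes "hilbert_space scaleK ip"
    and "separable_space (euclidean :: 'h topology)"
    and "bounded_operator scaleK A"
    and "stably_recoverable scaleK ip A g"
    and "lam \<ge> 0" and "\<mu> \<ge> 0" and "\<nu> \<ge> 0"
    and "\<And>(l::nat) (a :: nat \<Rightarrow> 'k).
      (norm (\<Sum>n=0..l. scaleK (a n) ((hilbert_adjoint ip A ^^ n) (g - h))))\<^sup>2
      \<le> lam * (norm (\<Sum>n=0..l. scaleK (a n) ((hilbert_adjoint ip A ^^ n) g)))\<^sup>2
        + \<mu> * norm (\<Sum>n=0..l. scaleK (a n) ((hilbert_adjoint ip A ^^ n) g))
            * norm (\<Sum>n=0..l. scaleK (a n) ((hilbert_adjoint ip A ^^ n) h))
        + \<nu> * (norm (\<Sum>n=0..l. scaleK (a n) ((hilbert_adjoint ip A ^^ n) h)))\<^sup>2"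
    and "\<epsilon> > 0"
    and "2 * (1 - \<nu>) * \<epsilon>\<^sup>2 - (\<mu> + 2 * \<nu>) * \<epsilon> - \<mu> > 0"
    and "max (lam + \<mu> * \<epsilon> / 2) (\<mu> / (2 * \<epsilon>) + \<nu>) < 1"
  shows "stably_recoverable scaleK ip A h"
proof -
  interpret hilbert_space scaleK ip by (rule assms(1))
  note A = assms(3) and le = assms(8) and eps = assms(9)
  define x where "x n = (hilbert_adjoint ip A ^^ n) g" for n
  define y where "y n = (hilbert_adjoint ip A ^^ n) h" for n
  define p where "p = lam + \<mu> * \<epsilon> / 2"
  define q where "q = \<mu> / (2 * \<epsilon>) + \<nu>"
  obtain a b where frame: "frame a b x"
    using stably_recoverable_imp_frame[OF A assms(4)] unfolding x_def[abs_def] by blast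
  have "\<exists>a' b'. frame a' b' y"
  proof (rule frame_perturbation[OF frame])
    show "0 \<le> p" "p < 1" "0 \<le> q" "q < 1"
      using assms(5-7,11) eps by (simp_all add: p_def q_def)
    fix N and c :: "nat \<Rightarrow> 'k"
    define u where "u = (\<Sum>n<N. scaleK (c n) (x n))"
    define v where "v = (\<Sum>n<N. scaleK (c n) (y n))"
    have "(norm (u - v))\<^sup>2 \<le> lam * (norm u)\<^sup>2 + \<mu> * norm u * norm v + \<nu> * (norm v)\<^sup>2"
    \<comment> \<open>The sums in the hypothesis run over \<open>0..l\<close> and have at least one
      term, so the empty sum is treated apart.\<close>
    proof (cases N)
      case (Suc l)
      have "{0..l} = {..<N}" by (auto simp: Suc)
      with le[of c l] show ?thesis
        by (simp add: u_def v_def x_def y_def hilbert_adjoint_funpow_diff[OF A] scale_right_diff_distrib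
            sum_subtractf)
    qed (simp add: u_def v_def)
    moreover have "\<mu> * norm u * norm v \<le> \<mu> * (\<epsilon> / 2 * (norm u)\<^sup>2 + 1 / (2 * \<epsilon>) * (norm v)\<^sup>2)"
    proof -
      \<comment> \<open>Dividing this square by \<open>2 * \<epsilon>\<close> makes the mixed term
        exactly \<open>norm u * norm v\<close> and the other coefficients those in \<open>p\<close>
        and \<open>q\<close>.\<close>
      have "0 \<le> (\<epsilon> * norm u - norm v)\<^sup>2 / (2 * \<epsilon>)"
        using eps by simp
      also have "\<dots> = \<epsilon> / 2 * (norm u)\<^sup>2 + 1 / (2 * \<epsilon>) * (norm v)\<^sup>2 - norm u * norm v"
        using eps by (simp add: power2_diff field_simps power2_eq_square)
      finally show ?thesis
        using assms(6) by (simp add: mult.assoc mult_left_mono)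
    qed
    ultimately show "(norm ((\<Sum>n<N. scaleK (c n) (x n)) - (\<Sum>n<N. scaleK (c n) (y n))))\<^sup>2
        \<le> p * (norm (\<Sum>n<N. scaleK (c n) (x n)))\<^sup>2 + q * (norm (\<Sum>n<N. scaleK (c n) (y n)))\<^sup>2"
      unfolding u_def[symmetric] v_def[symmetric] by (simp add: p_def q_def algebra_simps)
  qed
  then show ?thesis
    using frame_imp_stably_recoverable[OF A] unfolding y_def[abs_def] by blast
qed

end
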